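(* Let $X$ be a locally convex real vector space and let $T : X \to X$ be a continuous linear operator with a hypercyclic vector $x \in X$. Then $P(T)x$ is a hypercyclic vector for $T$ for every non-zero polynomial $P$ with real coefficients.
   Context: Let $X$ be a locally convex vector space and $T : X \to X$ a continuous linear operator. For $x \in X$, the orbit of $x$ under $T$ is $\mathrm{Orb}\{x, T\} = \{x, Tx, T^2x, \dots\}$. A vector $x \in X$ is called a hypercyclic vector for $T$ if $\mathrm{Orb}\{x,T\}$ is dense in $X$. For a polynomial $P(t) = \sum_{k=0}^{d} c_k t^k$, $P(T)$ denotes the operator $\sum_{k=0}^{d} c_k T^k$, with $T^0 = I$ the identity. *)

theory Defs
  imports "HOL-Analysis.Analysis" "HOL-Computational_Algebra.Polynomial"
begin

text \<open>
  Locally convex real vector spaces: real topological vector spaces in which the origin has a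
  local base of convex open sets. No separation axiom is assumed, so Hausdorff spaces are a
  special case. Joint continuity of scalar multiplication is stated with a product filter, in
  the style of the library class \<^class>\<open>topological_monoid_add\<close>.
  The constant \<^const>\<open>convex\<close> requires a \<^class>\<open>real_vector\<close> instance and cannot occur in
  the class specification, so its definition is unfolded there.
\<close>

class locally_convex_space = real_vector + topological_ab_group_add +
  assumes tendsto_scaleR_Pair:
    "LIM p (nhds (r::real) \<times>\<^sub>F nhds x). fst p *\<^sub>R snd p :> nhds (r *\<^sub>R x)"
  and convex_local_base:
    "open U \<Longrightarrow> 0 \<in> U \<Longrightarrow> \<exists>V. open V \<and> 0 \<in> V \<and>
       (\<forall>a\<in>V. \<forall>b\<in>V. \<forall>u\<ge>0. \<forall>v\<ge>0. u + v = 1 \<longrightarrow> u *\<^sub>R a + v *\<^sub>R b \<in> V) \<and> V \<subseteq> U"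

lemma locally_convex_space_convex_base:
  fixes U :: "'a::locally_convex_space set"
  assumes "open U" "0 \<in> U"
  shows "\<exists>V. open V \<and> 0 \<in> V \<and> convex V \<and> V \<subseteq> U"
  using convex_local_base[OF assms] by (simp add: convex_def)

text \<open>Every normed space is locally convex, so the class covers the classical examples.\<close>

instance real_normed_vector \<subseteq> locally_convex_space
proof
  fix r :: real and x :: 'a
  show "LIM p (nhds r \<times>\<^sub>F nhds x). fst p *\<^sub>R snd p :> nhds (r *\<^sub>R x)"
    by (intro tendsto_scaleR filterlim_fst filterlim_snd)
next
  fix U :: "'a set"
  assume "open U" "0 \<in> U"
  then obtain e where "e > 0" "ball 0 e \<subseteq> U"
    by (meson openE)
  then have "open (ball 0 e) \<and> 0 \<in> ball 0 e \<and> convex (ball (0::'a) e) \<and> ball 0 e \<subseteq> U"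
    by simp
  then show "\<exists>V. open V \<and> 0 \<in> V \<and>
       (\<forall>a\<in>V. \<forall>b\<in>V. \<forall>u\<ge>0. \<forall>v\<ge>0. u + v = 1 \<longrightarrow> u *\<^sub>R a + v *\<^sub>R b \<in> V) \<and> V \<subseteq> U"
    unfolding convex_def by blast
qed

definition orbit :: "('a \<Rightarrow> 'a) \<Rightarrow> 'a \<Rightarrow> 'a set" where
  "orbit T x = range (\<lambda>n. (T ^^ n) x)"

definition hypercyclic_vector :: "('a::topological_space \<Rightarrow> 'a) \<Rightarrow> 'a \<Rightarrow> bool" where
  "hypercyclic_vector T x \<longleftrightarrow> closure (orbit T x) = UNIV"

definition poly_operator :: "real poly \<Rightarrow> ('a::real_vector \<Rightarrow> 'a) \<Rightarrow> 'a \<Rightarrow> 'a" where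
  "poly_operator P T x = (\<Sum>k\<le>degree P. coeff P k *\<^sub>R (T ^^ k) x)"

end

theory Submission
  imports Defs "HOL-Computational_Algebra.Fundamental_Theorem_Algebra"
begin

text \<open>
  The orbit of \<open>P(T) x\<close> is the image of the orbit of \<open>x\<close> under the continuous operator
  \<open>P(T)\<close>, which commutes with \<open>T\<close>. As the orbit of \<open>x\<close> is dense, its image is dense in the
  range of \<open>P(T)\<close>, so everything reduces to showing that this range is dense in the space
  (\<open>hypercyclic_dense_range_poly_operator\<close>).

  If it were not, the Hahn-Banach theorem (\<open>separate_point_from_subspace\<close>) would yield a nonzero
  continuous linear functional \<open>f\<close> with \<open>f \<circ> P(T) = 0\<close>. Regard \<open>f\<close> as complex-valued and split
  \<open>P\<close> into linear factors over the complex numbers. Applying the factors to \<open>f\<close> one at a time,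
  in the step at which the functional becomes zero one meets a nonzero functional \<open>g\<close> with
  \<open>g \<circ> T = l \<cdot> g\<close> for some complex \<open>l\<close> (\<open>hypercyclic_no_annihilated_functional\<close>). Only the
  functionals are made complex, so \<open>T\<close> stays a real operator, and conjugate pairs of roots of
  \<open>P\<close> need no separate treatment.

  Such a \<open>g\<close> cannot exist (\<open>hypercyclic_no_eigenfunctional\<close>). The absolute value of \<open>g\<close> takes the
  values \<open>\<bar>l\<bar>\<^sup>n \<bar>g x\<bar>\<close> along the dense orbit of \<open>x\<close>, so this geometric sequence would have to be
  dense in the set \<open>[0, \<infinity>)\<close> of all values of \<open>\<bar>g\<bar>\<close>; but it is bounded if \<open>\<bar>l\<bar> \<le> 1\<close>, and
  otherwise it is bounded away from \<open>0\<close> unless it vanishes.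

  The Hahn-Banach theorem is obtained from the fact that a minimal sublinear functional is linear
  (\<open>hahn_banach_sublinear\<close>), applied to a Minkowski functional.
\<close>

section \<open>A Hahn-Banach theorem for sublinear functionals\<close>

text \<open>
  Only an inequality is required for positive homogeneity, which makes sublinearity easier to
  establish; replacing \<open>c\<close> by its inverse gives the equation (\<open>sublinear_scaleR\<close>).
\<close>
definition sublinear :: "('a::real_vector \<Rightarrow> real) \<Rightarrow> bool" where
  "sublinear q \<longleftrightarrow> (\<forall>x y. q (x + y) \<le> q x + q y) \<and> (\<forall>c>0. \<forall>x. q (c *\<^sub>R x) \<le> c * q x)"

lemma sublinear_add: "sublinear q \<Longrightarrow> q (x + y) \<le> q x + q y"
  by (simp add: sublinear_def)

lemma sublinear_scaleR_le: "sublinear q \<Longrightarrow> c > 0 \<Longrightarrow> q (c *\<^sub>R x) \<le> c * q x"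
  by (simp add: sublinear_def)

lemma sublinear_0:
  assumes "sublinear q" shows "q 0 = 0"
proof -
  have "q 0 \<le> 2 * q 0" "q 0 \<le> (1/2) * q 0"
    using sublinear_scaleR_le[OF assms, of 2 0] sublinear_scaleR_le[OF assms, of "1/2" 0] by simp_all
  then show ?thesis by linarith
qed

lemma sublinear_scaleR:
  assumes q: "sublinear q" and c: "c \<ge> 0" shows "q (c *\<^sub>R x) = c * q x"
proof (cases "c = 0")
  case True
  then show ?thesis using sublinear_0[OF q] by simp
next
  case False
  with c have "c > 0" by simp
  have "q x \<le> inverse c * q (c *\<^sub>R x)"
    using sublinear_scaleR_le[OF q, of "inverse c" "c *\<^sub>R x"] \<open>c > 0\<close> by simp
  then have "c * q x \<le> q (c *\<^sub>R x)"
    using \<open>c > 0\<close> by (simp add: field_simps)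
  with sublinear_scaleR_le[OF q \<open>c > 0\<close>] show ?thesis by (simp add: antisym)
qed

lemma sublinear_minus_le:
  assumes "sublinear q" shows "- q (- x) \<le> q x"
  using sublinear_add[OF assms, of x "- x"] sublinear_0[OF assms] by simp

text \<open>
  This one construction serves twice in the proof of the Hahn-Banach theorem: applied to a
  minimal functional it forces that functional to be odd, and applied to the given functional it
  pins down the value at a prescribed point. The functional \<open>r\<close> is the largest sublinear one
  below \<open>q\<close> with \<open>r (- y) \<le> - q y\<close>.
\<close>
lemma sublinear_decrease:
  assumes q: "sublinear q"
  obtains r where "sublinear r" "r \<le> q" "r (- y) \<le> - q y"
proof -
  define r where "r x = (INF t\<in>{0..}. q (x + t *\<^sub>R y) - t * q y)" for x
  have lower: "- q (- x) \<le> q (x + t *\<^sub>R y) - t * q y" if "t \<ge> 0" for x t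
    using sublinear_add[OF q, of "x + t *\<^sub>R y" "- x"] sublinear_scaleR[OF q that, of y] by simp
  have bdd: "bdd_below ((\<lambda>t. q (x + t *\<^sub>R y) - t * q y) ` {0..})" for x
    using lower by (intro bdd_belowI2) auto
  have r_le: "r x \<le> q (x + t *\<^sub>R y) - t * q y" if "t \<ge> 0" for x t
    unfolding r_def using that by (intro cINF_lower[OF bdd]) auto
  have r_ge: "a \<le> r x" if "\<And>t. t \<ge> 0 \<Longrightarrow> a \<le> q (x + t *\<^sub>R y) - t * q y" for a x
    unfolding r_def using that by (intro cINF_greatest) auto
  have add: "r (x + z) \<le> r x + r z" for x z
  proof -
    have *: "r (x + z) \<le> (q (x + t *\<^sub>R y) - t * q y) + (q (z + s *\<^sub>R y) - s * q y)"
      if "t \<ge> 0" "s \<ge> 0" for s t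
      using r_le[of "t + s" "x + z"] that sublinear_add[OF q, of "x + t *\<^sub>R y" "z + s *\<^sub>R y"]
      by (simp add: algebra_simps)
    have "r (x + z) - (q (x + t *\<^sub>R y) - t * q y) \<le> r z" if "t \<ge> 0" for t
      by (intro r_ge) (use *[OF that] in force)
    then have "r (x + z) - r z \<le> r x"
      by (intro r_ge) force
    then show ?thesis by simp
  qed
  have scale: "r (c *\<^sub>R x) \<le> c * r x" if "c > 0" for c x
  proof -
    have "inverse c * r (c *\<^sub>R x) \<le> r x"
    proof (rule r_ge)
      fix t :: real assume "t \<ge> 0"
      have "r (c *\<^sub>R x) \<le> q (c *\<^sub>R (x + t *\<^sub>R y)) - (c * t) * q y"
        using r_le[of "c * t" "c *\<^sub>R x"] \<open>t \<ge> 0\<close> \<open>c > 0\<close> by (simp add: scaleR_add_right)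
      also have "\<dots> = c * (q (x + t *\<^sub>R y) - t * q y)"
        using sublinear_scaleR[OF q, of c "x + t *\<^sub>R y"] \<open>c > 0\<close> by (simp add: algebra_simps)
      finally show "inverse c * r (c *\<^sub>R x) \<le> q (x + t *\<^sub>R y) - t * q y"
        using \<open>c > 0\<close> by (simp add: field_simps)
    qed
    then show ?thesis using \<open>c > 0\<close> by (simp add: field_simps)
  qed
  show ?thesis
  proof
    show "sublinear r" using add scale by (simp add: sublinear_def)
    show "r \<le> q" using r_le[of 0] by (simp add: le_fun_def)
    show "r (- y) \<le> - q y" using r_le[of 1 "- y"] sublinear_0[OF q] by simp
  qed
qed

text \<open>
  Zorn's lemma applies because the pointwise infimum of a chain of sublinear functionals is again
  sublinear: it is finite since \<open>f x \<ge> - f (- x) \<ge> - p (- x)\<close> for every sublinear \<open>f \<le> p\<close>, and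
  subadditive since two members of a chain have the smaller one as a common lower bound.
\<close>
lemma minimal_sublinear_exists:
  assumes p: "sublinear p"
  obtains q where "sublinear q" "q \<le> p" "\<And>r. sublinear r \<Longrightarrow> r \<le> q \<Longrightarrow> r = q"
proof -
  define A where "A = {q. sublinear q \<and> q \<le> p}"
  have "\<exists>m\<in>A. \<forall>a\<in>A. a \<le> m \<longrightarrow> a = m"
  proof (rule predicate_Zorn)
    show "partial_order_on A (relation_of (\<lambda>q r. r \<le> q) A)"
      by (intro partial_order_on_relation_ofI) auto
    fix C assume C: "C \<in> Chains (relation_of (\<lambda>q r. r \<le> q) A)"
    show "\<exists>u\<in>A. \<forall>a\<in>C. u \<le> a"
    proof (cases "C = {}")
      case True
      then show ?thesis using p by (auto simp: A_def)
    next
      case False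
      have CA: "C \<subseteq> A" and tot: "\<And>f g. f \<in> C \<Longrightarrow> g \<in> C \<Longrightarrow> f \<le> g \<or> g \<le> f"
        using C by (auto simp: Chains_def relation_of_def)
      define u where "u x = (INF f\<in>C. f x)" for x
      have lower: "- p (- x) \<le> f x" if "f \<in> C" for f x
      proof -
        have "sublinear f" "f (- x) \<le> p (- x)"
          using that CA by (auto simp: A_def le_fun_def)
        then show ?thesis using sublinear_minus_le[of f x] by linarith
      qed
      have u_le: "u x \<le> f x" if "f \<in> C" for f x
        unfolding u_def using lower that by (intro cINF_lower bdd_belowI2) auto
      have u_ge: "a \<le> u x" if "\<And>f. f \<in> C \<Longrightarrow> a \<le> f x" for a x
        unfolding u_def using that False by (intro cINF_greatest) auto
      have "sublinear u"
        unfolding sublinear_def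
      proof (intro conjI allI impI)
        fix x y
        have *: "u (x + y) \<le> f x + g y" if fg: "f \<in> C" "g \<in> C" for f g
        proof -
          obtain h where h: "h \<in> C" "h \<le> f" "h \<le> g"
            using tot[OF fg] fg by blast
          have "u (x + y) \<le> h (x + y)" using u_le h by blast
          also have "\<dots> \<le> h x + h y" using h CA by (auto simp: A_def intro: sublinear_add)
          also have "\<dots> \<le> f x + g y" using h by (intro add_mono) (auto simp: le_fun_def)
          finally show ?thesis .
        qed
        have "u (x + y) - f x \<le> u y" if "f \<in> C" for f
          by (intro u_ge) (use *[OF that] in force)
        then have "u (x + y) - u y \<le> u x"
          by (intro u_ge) force
        then show "u (x + y) \<le> u x + u y" by simp
      next
        fix c :: real and x assume "c > 0"
        have "inverse c * u (c *\<^sub>R x) \<le> u x"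
        proof (rule u_ge)
          fix f assume "f \<in> C"
          then have "u (c *\<^sub>R x) \<le> c * f x"
            using u_le[of f "c *\<^sub>R x"] sublinear_scaleR_le[of f c x] CA \<open>c > 0\<close>
            by (force simp: A_def)
          then show "inverse c * u (c *\<^sub>R x) \<le> f x"
            using \<open>c > 0\<close> by (simp add: field_simps)
        qed
        then show "u (c *\<^sub>R x) \<le> c * u x" using \<open>c > 0\<close> by (simp add: field_simps)
      qed
      moreover obtain f where "f \<in> C" using False by blast
      then have "u \<le> f" "f \<le> p" using u_le CA by (auto simp: le_fun_def A_def)
      then have "u \<le> p" by (rule order_trans)
      ultimately show ?thesis using u_le by (auto simp: A_def le_fun_def)
    qed
  qed
  then show ?thesis using that unfolding A_def by (blast intro: order_trans)
qed

text \<open>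
  Once a minimal functional is odd, subadditivity at \<open>x, y\<close> and at \<open>- x, - y\<close> together give
  additivity. Lowering \<open>p\<close> at \<open>- v\<close> before passing to a minimal functional is what makes the
  bound \<open>f v \<le> p v\<close> an equality.
\<close>
theorem hahn_banach_sublinear:
  assumes p: "sublinear p"
  obtains f where "linear f" "\<And>x. f x \<le> p x" "f v = p v"
proof -
  obtain r where r: "sublinear r" "r \<le> p" "r (- v) \<le> - p v"
    using sublinear_decrease[OF p] .
  obtain f where f: "sublinear f" "f \<le> r" and min: "\<And>g. sublinear g \<Longrightarrow> g \<le> f \<Longrightarrow> g = f"
    using minimal_sublinear_exists[OF r(1)] by blast
  have neg: "f (- y) = - f y" for y
  proof -
    obtain g where "sublinear g" "g \<le> f" "g (- y) \<le> - f y"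
      using sublinear_decrease[OF f(1)] .
    then have "f (- y) \<le> - f y" using min by blast
    then show ?thesis using sublinear_minus_le[OF f(1), of y] by linarith
  qed
  have add: "f (x + y) = f x + f y" for x y
    using sublinear_add[OF f(1), of x y] sublinear_add[OF f(1), of "- x" "- y"]
      neg[of "x + y"] neg[of x] neg[of y] by (simp add: algebra_simps)
  have scale: "f (c *\<^sub>R x) = c * f x" for c x
  proof (cases "c \<ge> 0")
    case True then show ?thesis by (rule sublinear_scaleR[OF f(1)])
  next
    case False
    then show ?thesis using sublinear_scaleR[OF f(1), of "- c" x] neg[of "c *\<^sub>R x"] by simp
  qed
  have le: "f x \<le> p x" for x using f(2) r(2) by (meson le_fun_def order_trans)
  have "f (- v) \<le> - p v" using f(2) r(3) by (meson le_fun_def order_trans)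
  with neg le[of v] have "f v = p v" by simp
  moreover have "linear f" using add scale by (intro linearI) auto
  ultimately show ?thesis using that le by blast
qed

section \<open>Continuous functionals on locally convex spaces\<close>

definition minkowski_functional :: "'a::real_vector set \<Rightarrow> 'a \<Rightarrow> real" where
  "minkowski_functional U x = Inf {s. s > 0 \<and> x \<in> (*\<^sub>R) s ` U}"

lemma minkowski_functional_le:
  "s > 0 \<Longrightarrow> u \<in> U \<Longrightarrow> minkowski_functional U (s *\<^sub>R u) \<le> s"
  unfolding minkowski_functional_def by (intro cInf_lower bdd_belowI[of _ 0]) auto

lemma sublinear_minkowski_functional:
  assumes U: "convex U" and absorb: "\<And>x. \<exists>s>0. x \<in> (*\<^sub>R) s ` U"
  shows "sublinear (minkowski_functional U)"
proof -
  let ?p = "minkowski_functional U"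
  have p_ge: "a \<le> ?p x" if "\<And>s u. s > 0 \<Longrightarrow> u \<in> U \<Longrightarrow> x = s *\<^sub>R u \<Longrightarrow> a \<le> s" for a x
    unfolding minkowski_functional_def using that absorb[of x] by (intro cInf_greatest) auto
  show ?thesis
    unfolding sublinear_def
  proof (intro conjI allI impI)
    fix x y
    have *: "?p (x + y) \<le> s + t"
      if "s > 0" "u \<in> U" "x = s *\<^sub>R u" "t > 0" "w \<in> U" "y = t *\<^sub>R w" for s u t w
    proof -
      have "s / (s + t) + t / (s + t) = 1"
        using that by (simp flip: add_divide_distrib)
      then have "(s / (s + t)) *\<^sub>R u + (t / (s + t)) *\<^sub>R w \<in> U"
        using that by (intro convexD[OF U]) auto
      from minkowski_functional_le[OF _ this, of "s + t"] that show ?thesis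
        by (simp add: scaleR_add_right)
    qed
    have "?p (x + y) - s \<le> ?p y" if "s > 0" "u \<in> U" "x = s *\<^sub>R u" for s u
      by (intro p_ge) (use *[OF that] in force)
    then have "?p (x + y) - ?p y \<le> ?p x"
      by (intro p_ge) force
    then show "?p (x + y) \<le> ?p x + ?p y" by simp
  next
    fix c :: real and x :: 'a assume "c > 0"
    have "inverse c * ?p (c *\<^sub>R x) \<le> ?p x"
    proof (rule p_ge)
      fix s u assume "s > 0" "u \<in> U" "x = s *\<^sub>R u"
      then have "?p (c *\<^sub>R x) \<le> c * s"
        using minkowski_functional_le[of "c * s" u U] \<open>c > 0\<close> by simp
      then show "inverse c * ?p (c *\<^sub>R x) \<le> s" using \<open>c > 0\<close> by (simp add: field_simps)
    qed
    then show "?p (c *\<^sub>R x) \<le> c * ?p x" using \<open>c > 0\<close> by (simp add: field_simps)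
  qed
qed

lemma minkowski_functional_ge_1:
  assumes U: "convex U" and absorb: "\<And>x. \<exists>s>0. x \<in> (*\<^sub>R) s ` U" and v: "v \<notin> U"
  shows "minkowski_functional U v \<ge> 1"
  unfolding minkowski_functional_def
proof (rule cInf_greatest)
  show "{s. s > 0 \<and> v \<in> (*\<^sub>R) s ` U} \<noteq> {}" using absorb by blast
  fix s assume "s \<in> {s. s > 0 \<and> v \<in> (*\<^sub>R) s ` U}"
  then obtain u where s: "s > 0" and u: "u \<in> U" "v = s *\<^sub>R u" by blast
  have "0 \<in> U" using absorb[of 0] by auto
  show "1 \<le> s"
  proof (rule ccontr)
    assume "\<not> 1 \<le> s"
    then have "s *\<^sub>R u + (1 - s) *\<^sub>R 0 \<in> U"
      using s u \<open>0 \<in> U\<close> by (intro convexD[OF U]) auto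
    with u v show False by simp
  qed
qed

lemma continuous_on_scaleR_lcs [continuous_intros]:
  fixes f :: "'b::topological_space \<Rightarrow> 'a::locally_convex_space"
  assumes "continuous_on S c" "continuous_on S f"
  shows "continuous_on S (\<lambda>x. c x *\<^sub>R f x)"
  unfolding continuous_on_def
proof
  fix x assume "x \<in> S"
  then have "(c \<longlongrightarrow> c x) (at x within S)" "(f \<longlongrightarrow> f x) (at x within S)"
    using assms by (auto simp: continuous_on_def)
  then have "LIM y at x within S. (c y, f y) :> nhds (c x) \<times>\<^sub>F nhds (f x)"
    by (rule filterlim_Pair)
  from filterlim_compose[OF tendsto_scaleR_Pair this]
  show "((\<lambda>y. c y *\<^sub>R f y) \<longlongrightarrow> c x *\<^sub>R f x) (at x within S)" by simp
qed

text \<open>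
  A one-sided bound is enough, because near \<open>x0\<close> both multiples
  \<open>\<plusminus> (2 / e) *\<^sub>R (x - x0)\<close> lie in \<open>V\<close>.
\<close>
lemma linear_functional_continuous:
  fixes f :: "'a::locally_convex_space \<Rightarrow> real"
  assumes f: "linear f" and V: "open V" "0 \<in> V" and le: "\<And>x. x \<in> V \<Longrightarrow> f x \<le> 1"
  shows "continuous_on UNIV f"
  unfolding continuous_on_def
proof
  fix x0 :: 'a
  show "(f \<longlongrightarrow> f x0) (at x0 within UNIV)"
  proof (rule tendstoI)
    fix e :: real assume "e > 0"
    have ev: "\<forall>\<^sub>F x in at x0. c *\<^sub>R (x - x0) \<in> V" for c
    proof -
      have "continuous_on UNIV (\<lambda>x. c *\<^sub>R (x - x0))" by (intro continuous_intros)
      then have "((\<lambda>x. c *\<^sub>R (x - x0)) \<longlongrightarrow> c *\<^sub>R (x0 - x0)) (at x0)"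
        unfolding continuous_on_def by blast
      then show ?thesis using V by (auto dest: topological_tendstoD)
    qed
    have "\<forall>\<^sub>F x in at x0. dist (f x) (f x0) < e"
      using ev[of "2 / e"] ev[of "- (2 / e)"]
    proof eventually_elim
      case (elim x)
      have "(2 / e) * (f x - f x0) \<le> 1" "- (2 / e) * (f x - f x0) \<le> 1"
        using le[OF elim(1)] le[OF elim(2)] by (simp_all add: linear_diff[OF f] linear_scale[OF f] linear_neg[OF f])
      then have "2 * (f x - f x0) \<le> e" "- (2 * (f x - f x0)) \<le> e"
        using \<open>e > 0\<close> by (simp_all add: field_simps)
      then show ?case using \<open>e > 0\<close> by (auto simp: dist_real_def)
    qed
    then show "\<forall>\<^sub>F x in at x0 within UNIV. dist (f x) (f x0) < e" by simp
  qed
qed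

lemma absorbing_open:
  fixes V :: "'a::locally_convex_space set"
  assumes V: "open V" "0 \<in> V"
  shows "\<exists>s>0. x \<in> (*\<^sub>R) s ` V"
proof -
  have "continuous_on UNIV (\<lambda>t::real. t *\<^sub>R x)" by (intro continuous_intros)
  then have "((\<lambda>t::real. t *\<^sub>R x) \<longlongrightarrow> 0 *\<^sub>R x) (at 0)"
    unfolding continuous_on_def by blast
  then have "\<forall>\<^sub>F t::real in at 0. t *\<^sub>R x \<in> V"
    using V by (auto dest: topological_tendstoD)
  then have "\<forall>\<^sub>F t::real in at_right 0. t *\<^sub>R x \<in> V"
    by (simp add: eventually_at_split)
  then obtain b :: real where "b > 0" and b: "\<And>t. t > 0 \<Longrightarrow> t < b \<Longrightarrow> t *\<^sub>R x \<in> V"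
    by (auto simp: eventually_at_right_field)
  have "(b / 2) *\<^sub>R x \<in> V" using b \<open>b > 0\<close> by simp
  moreover have "x = (2 / b) *\<^sub>R ((b / 2) *\<^sub>R x)" using \<open>b > 0\<close> by simp
  ultimately have "x \<in> (*\<^sub>R) (2 / b) ` V" by (rule image_eqI[rotated])
  then show ?thesis using \<open>b > 0\<close> by (intro exI[of _ "2 / b"]) simp
qed

text \<open>
  The convex set \<open>U = M + V\<close>, with \<open>V\<close> so small that \<open>v \<notin> U\<close>, carries all the information: a
  linear functional below its Minkowski functional is at most \<open>1\<close> on the subspace \<open>M \<subseteq> U\<close>,
  hence zero there, and at most \<open>1\<close> on the neighbourhood \<open>V \<subseteq> U\<close>, hence continuous.
\<close>
theorem separate_point_from_subspace:
  fixes M :: "'a::locally_convex_space set"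
  assumes M: "subspace M" and v: "v \<notin> closure M"
  obtains f :: "'a \<Rightarrow> real" where
    "linear f" "continuous_on UNIV f" "\<And>m. m \<in> M \<Longrightarrow> f m = 0" "f v \<noteq> 0"
proof -
  define W where "W = (\<lambda>w. v - w) -` (- closure M)"
  have "open W" unfolding W_def by (intro open_vimage continuous_intros) auto
  moreover have "0 \<in> W" using v by (simp add: W_def)
  ultimately obtain V where V: "open V" "0 \<in> V" "convex V" "V \<subseteq> W"
    using locally_convex_space_convex_base by metis
  define U where "U = (\<Union>m\<in>M. \<Union>w\<in>V. {m + w})"
  have "0 \<in> M" using M by (rule subspace_0)
  have MU: "M \<subseteq> U" and VU: "V \<subseteq> U"
    using V(2) \<open>0 \<in> M\<close> unfolding U_def by force+
  have U: "convex U" unfolding U_def by (rule convex_sums[OF subspace_imp_convex[OF M] V(3)])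
  have absorb: "\<exists>s>0. x \<in> (*\<^sub>R) s ` U" for x
    using absorbing_open[OF V(1,2), of x] VU by blast
  have "v \<notin> U"
  proof
    assume "v \<in> U"
    then obtain m w where "m \<in> M" "w \<in> V" "v = m + w" by (auto simp: U_def)
    then have "v - w \<in> closure M" using closure_subset by auto
    with \<open>w \<in> V\<close> V(4) show False by (auto simp: W_def)
  qed
  obtain f where f: "linear f" "\<And>x. f x \<le> minkowski_functional U x" "f v = minkowski_functional U v"
    using hahn_banach_sublinear[OF sublinear_minkowski_functional[OF U absorb]] by blast
  have f1: "f u \<le> 1" if "u \<in> U" for u
    using f(2)[of u] minkowski_functional_le[of 1 u U] that by simp
  show ?thesis
  proof
    show "linear f" by fact
    show "continuous_on UNIV f" using f(1) V(1,2) f1 VU by (intro linear_functional_continuous) auto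
    show "f v \<noteq> 0" using f(3) minkowski_functional_ge_1[OF U absorb \<open>v \<notin> U\<close>] by simp
    fix m assume "m \<in> M"
    show "f m = 0"
    proof (rule ccontr)
      assume "f m \<noteq> 0"
      have "(2 / f m) *\<^sub>R m \<in> U" using \<open>m \<in> M\<close> M MU by (auto intro: subspace_scale)
      from f1[OF this] show False using \<open>f m \<noteq> 0\<close> by (simp add: linear_scale[OF f(1)])
    qed
  qed
qed

section \<open>Eigenfunctionals of a hypercyclic operator\<close>

lemma linear_funpow:
  fixes T :: "'a::real_vector \<Rightarrow> 'a"
  assumes "linear T" shows "linear (T ^^ n)"
proof (induction n)
  case (Suc n)
  then show ?case using linear_compose[OF Suc assms] by (simp add: o_def)
qed (auto intro: linearI)

lemma continuous_on_funpow:
  fixes T :: "'a::topological_space \<Rightarrow> 'a"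
  assumes "continuous_on UNIV T" shows "continuous_on UNIV (T ^^ n)"
proof (induction n)
  case (Suc n)
  have "continuous_on ((T ^^ n) ` UNIV) T" using assms continuous_on_subset by blast
  from continuous_on_compose[OF Suc this] show ?case by simp
qed (simp add: id_def)

text \<open>
  In more familiar terms: the adjoint of a hypercyclic operator has no eigenvectors, even among
  complex-valued functionals.
\<close>
lemma hypercyclic_no_eigenfunctional:
  fixes T :: "'a::{real_vector, topological_space} \<Rightarrow> 'a" and g :: "'a \<Rightarrow> complex"
  assumes hc: "hypercyclic_vector T x"
    and g: "linear g" "continuous_on UNIV g" and eigen: "\<And>y. g (T y) = l * g y"
  shows "g y = 0"
proof (rule ccontr)
  assume "g y \<noteq> 0"
  have orb: "norm (g ((T ^^ n) x)) = norm l ^ n * norm (g x)" for n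
    by (induction n) (auto simp: eigen norm_mult)
  have dense: "norm (g z) \<in> S" if "closed S" and S: "\<And>n. norm l ^ n * norm (g x) \<in> S" for S z
  proof -
    have "continuous_on (closure (orbit T x)) (\<lambda>z. norm (g z))"
      using g(2) continuous_on_subset by (intro continuous_intros) blast
    then have "(\<lambda>z. norm (g z)) ` closure (orbit T x) \<subseteq> S"
      using \<open>closed S\<close> S orb by (intro image_closure_subset) (auto simp: orbit_def)
    then show ?thesis using hc by (auto simp: hypercyclic_vector_def)
  qed
  \<comment> \<open>In the expanding case the orbit values stay above \<open>norm (g x)\<close>, and by density so does the
    value \<open>0\<close> at the origin; hence \<open>g x = 0\<close> and the same upper bound holds trivially.\<close>
  have "norm l ^ n * norm (g x) \<le> norm (g x)" for n
  proof (cases "norm l \<le> 1")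
    case True
    then show ?thesis by (simp add: power_le_one mult_left_le_one_le)
  next
    case False
    then have "norm (g x) \<le> norm l ^ n * norm (g x)" for n
      using mult_right_mono[OF one_le_power[of "norm l" n], of "norm (g x)"] by simp
    then have "norm (g 0) \<in> {norm (g x)..}" by (intro dense) auto
    then have "g x = 0" by (simp add: linear_0[OF g(1)])
    then show ?thesis by simp
  qed
  then have bound: "norm (g z) \<le> norm (g x)" for z
    using dense[of "{..norm (g x)}" z] by auto
  define c where "c = (norm (g x) + 1) / norm (g y)"
  have "norm (g (c *\<^sub>R y)) = norm (g x) + 1"
    using \<open>g y \<noteq> 0\<close> by (simp add: linear_scale[OF g(1)] c_def)
  with bound[of "c *\<^sub>R y"] show False by simp
qed

text \<open>
  Induction on the degree. For a root \<open>l\<close> write \<open>P = (t - l) Q\<close>; then \<open>h = g \<circ> T - l \<cdot> g\<close> is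
  annihilated by \<open>Q\<close>, so it is zero, which makes \<open>g\<close> an eigenfunctional. Complex coefficients
  are needed precisely so that such a root exists.
\<close>
lemma hypercyclic_no_annihilated_functional:
  fixes T :: "'a::{real_vector, topological_space} \<Rightarrow> 'a" and g :: "'a \<Rightarrow> complex"
  assumes hc: "hypercyclic_vector T x" and T: "linear T" "continuous_on UNIV T"
    and "P \<noteq> 0" "linear g" "continuous_on UNIV g"
    and "\<And>y. (\<Sum>k\<le>degree P. coeff P k * g ((T ^^ k) y)) = 0"
  shows "g y = 0"
  using assms(4-)
proof (induction "degree P" arbitrary: P g y)
  case 0
  then obtain a where "P = [:a:]" by (metis degree_eq_zeroE)
  with 0 show ?case by auto
next
  case (Suc n)
  then obtain l where "poly P l = 0"
    using fundamental_theorem_of_algebra_alt[of P] by (metis degree_pCons_0 nat.distinct(1))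
  then obtain Q where P: "P = [:-l, 1:] * Q" by (metis dvdE poly_eq_0_iff_dvd)
  have "Q \<noteq> 0" using P \<open>P \<noteq> 0\<close> by auto
  then have "degree P = Suc (degree Q)" unfolding P by (subst degree_mult_eq) auto
  with Suc.hyps have n: "n = degree Q" by simp
  define h where "h y = g (T y) - l * g y" for y
  have "linear h"
    unfolding h_def using linear_add[OF Suc.prems(2)] linear_scale[OF Suc.prems(2)]
      linear_add[OF T(1)] linear_scale[OF T(1)]
    by (intro linearI) (auto simp: algebra_simps)
  moreover have "continuous_on UNIV h"
    unfolding h_def using continuous_on_compose2[OF Suc.prems(3) T(2)] Suc.prems(3)
    by (intro continuous_intros) auto
  moreover have "(\<Sum>k\<le>degree Q. coeff Q k * h ((T ^^ k) y)) = 0" for y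
  proof -
    let ?a = "\<lambda>k. g ((T ^^ k) y)"
    have "0 = (\<Sum>k\<le>Suc n. coeff P k * ?a k)"
      using Suc.prems(4)[of y] Suc.hyps by simp
    also have "\<dots> = (\<Sum>k\<le>Suc n. coeff (pCons 0 Q) k * ?a k) - l * (\<Sum>k\<le>Suc n. coeff Q k * ?a k)"
      unfolding sum_distrib_left sum_subtractf[symmetric]
      by (intro sum.cong) (auto simp: P algebra_simps)
    also have "(\<Sum>k\<le>Suc n. coeff (pCons 0 Q) k * ?a k) = (\<Sum>k\<le>n. coeff Q k * ?a (Suc k))"
      by (subst sum.atMost_Suc_shift) simp
    also have "(\<Sum>k\<le>Suc n. coeff Q k * ?a k) = (\<Sum>k\<le>n. coeff Q k * ?a k)"
      by (simp add: n coeff_eq_0)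
    also have "(\<Sum>k\<le>n. coeff Q k * ?a (Suc k)) - l * (\<Sum>k\<le>n. coeff Q k * ?a k)
        = (\<Sum>k\<le>n. coeff Q k * h ((T ^^ k) y))"
      unfolding sum_distrib_left sum_subtractf[symmetric]
      by (intro sum.cong) (auto simp: h_def algebra_simps)
    finally show ?thesis by (simp add: n)
  qed
  ultimately have "h y = 0" for y
    using Suc.hyps(1)[OF n \<open>Q \<noteq> 0\<close>] by blast
  then have "g (T y) = l * g y" for y by (simp add: h_def)
  then show ?case using hypercyclic_no_eigenfunctional[OF hc Suc.prems(2,3)] by blast
qed

section \<open>Polynomials in a hypercyclic operator\<close>

lemma linear_poly_operator:
  assumes "linear T" shows "linear (poly_operator P T)"
  unfolding poly_operator_def
  using linear_add[OF linear_funpow[OF assms]] linear_scale[OF linear_funpow[OF assms]]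
  by (intro linearI) (auto simp: algebra_simps sum.distrib scaleR_sum_right)

lemma continuous_on_poly_operator:
  fixes T :: "'a::locally_convex_space \<Rightarrow> 'a"
  assumes "continuous_on UNIV T" shows "continuous_on UNIV (poly_operator P T)"
  unfolding poly_operator_def[abs_def]
  by (intro continuous_intros continuous_on_funpow[OF assms])

lemma orbit_poly_operator:
  assumes "linear T"
  shows "orbit T (poly_operator P T x) = poly_operator P T ` orbit T x"
proof -
  have comm: "(T ^^ n) ((T ^^ k) x) = (T ^^ k) ((T ^^ n) x)" for n k
    by (metis add.commute comp_apply funpow_add)
  have "(T ^^ n) (poly_operator P T x) = poly_operator P T ((T ^^ n) x)" for n
    unfolding poly_operator_def
    by (simp add: linear_sum[OF linear_funpow[OF assms]] linear_scale[OF linear_funpow[OF assms]]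
        comm[of n])
  then show ?thesis by (simp add: orbit_def image_image)
qed

lemma hypercyclic_dense_range_poly_operator:
  fixes T :: "'a::locally_convex_space \<Rightarrow> 'a"
  assumes T: "linear T" "continuous_on UNIV T" and hc: "hypercyclic_vector T x" and "P \<noteq> 0"
  shows "closure (range (poly_operator P T)) = UNIV"
proof (rule ccontr)
  assume "closure (range (poly_operator P T)) \<noteq> UNIV"
  then obtain v where v: "v \<notin> closure (range (poly_operator P T))" by blast
  have "subspace (range (poly_operator P T))"
    using linear_poly_operator[OF T(1)] by (intro linear_subspace_image) auto
  then obtain f :: "'a \<Rightarrow> real" where f: "linear f" "continuous_on UNIV f" "f v \<noteq> 0"
    and f0: "\<And>y. f (poly_operator P T y) = 0"
    using separate_point_from_subspace[OF _ v] by (metis rangeI)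
  define g where "g y = complex_of_real (f y)" for y
  have "linear g" unfolding g_def using linear_add[OF f(1)] linear_scale[OF f(1)]
    by (intro linearI) (auto simp: scaleR_conv_of_real)
  moreover have "continuous_on UNIV g" unfolding g_def using f(2) by (intro continuous_intros)
  moreover have "map_poly complex_of_real P \<noteq> 0" using \<open>P \<noteq> 0\<close> by (simp add: map_poly_eq_0_iff)
  moreover have "(\<Sum>k\<le>degree (map_poly complex_of_real P).
      coeff (map_poly complex_of_real P) k * g ((T ^^ k) y)) = 0" for y
  proof -
    have "(\<Sum>k\<le>degree P. coeff P k * f ((T ^^ k) y)) = 0"
      using f0[of y] by (simp add: poly_operator_def linear_sum[OF f(1)] linear_scale[OF f(1)])
    then have "complex_of_real (\<Sum>k\<le>degree P. coeff P k * f ((T ^^ k) y)) = 0" by simp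
    then show ?thesis by (simp add: g_def degree_map_poly coeff_map_poly)
  qed
  ultimately have "g v = 0"
    using hypercyclic_no_annihilated_functional[OF hc T] by blast
  with f(3) show False by (simp add: g_def)
qed

theorem mainTheorem3:
  fixes T :: "'a::locally_convex_space \<Rightarrow> 'a" and x :: 'a
  assumes "linear T"
    and "continuous_on UNIV T"
    and "hypercyclic_vector T x"
  shows "\<forall>P :: real poly. P \<noteq> 0 \<longrightarrow> hypercyclic_vector T (poly_operator P T x)"
proof (intro allI impI)
  fix P :: "real poly" assume "P \<noteq> 0"
  let ?D = "closure (poly_operator P T ` orbit T x)"
  have "poly_operator P T ` closure (orbit T x) \<subseteq> ?D"
    by (intro image_closure_subset closed_closure closure_subset
        continuous_on_subset[OF continuous_on_poly_operator[OF assms(2)]]) simp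
  then have "range (poly_operator P T) \<subseteq> ?D"
    using assms(3) by (simp add: hypercyclic_vector_def)
  then have "closure (range (poly_operator P T)) \<subseteq> ?D"
    by (simp add: closure_minimal)
  then show "hypercyclic_vector T (poly_operator P T x)"
    using hypercyclic_dense_range_poly_operator[OF assms \<open>P \<noteq> 0\<close>]
    by (auto simp: hypercyclic_vector_def orbit_poly_operator[OF assms(1)])
qed

end
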